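(* Let $X_d\subset\mathbb{P}^3$ be a smooth surface of degree $d\geq 3$ that contains the line $\ell=V(x_3,x_4)$ and let $I(X_d)=\langle f\rangle$. Suppose that $P:=(1:p_2:0:0)$ is a point such that $$\frac{\partial f}{\partial x_4}(P)\neq 0\quad\text{and}\quad \mathfrak{d}_2(f)(P)\neq 0 .$$ Then there is at most one line $\ell'\neq\ell$ such that $P\in\ell'\subset X_d$, and the following conditions are equivalent: (a) there exists a line $\ell'\neq\ell$ such that $P\in\ell'\subset X_d$; (b) all functions $\mathfrak{b}_j$ vanish at $P$, i.e. $\mathfrak{b}_0(P)=\ldots=\mathfrak{b}_{d-3}(P)=0$.
   Context: The base field $K$ is algebraically closed of characteristic zero, and $(x_1:x_2:x_3:x_4)$ are homogeneous coordinates on $\mathbb{P}^3$. Write $$f=\sum_{i,j,k,l}\alpha_{i,j,k,l}\,x_3^i x_4^j x_1^k x_2^l,\qquad \alpha_{i,j,k,l}\in K,$$ with $\alpha_{i,j,k,l}=0$ unless $i+j+k+l=d$. For $j=1,\dots,4$ put $$\mathfrak{d}_j(f):=\frac{\partial^2 f}{\partial x_j\partial x_3}\cdot\frac{\partial f}{\partial x_4}-\frac{\partial^2 f}{\partial x_j\partial x_4}\cdot\frac{\partial f}{\partial x_3}.$$ For a smooth surface containing $\ell$, neither $\partial f/\partial x_4$ nor $\mathfrak{d}_2(f)$ vanishes identically on $\ell$, so one may define the following rational functions on $\ell$: $$A:=-\frac{\mathfrak{d}_1(f)}{\mathfrak{d}_2(f)}\Big|_\ell,\quad B:=\frac{(\partial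 f/\partial x_3)\,\mathfrak{d}_4(f)-(\partial f/\partial x_4)\,\mathfrak{d}_3(f)}{2\,\mathfrak{d}_2(f)\,(\partial f/\partial x_4)}\Big|_\ell,\quad C:=-\frac{\partial f/\partial x_3}{\partial f/\partial x_4}\Big|_\ell .$$ For $k=0,\dots,d-3$ the rational function $\mathfrak{b}_k=\mathfrak{b}_k(f)\in K(x_1,x_2)$ on $\ell$ is $$\mathfrak{b}_k:=\sum_{\substack{j_1,j_2,j_3\geq 0\\ j_1+j_2\leq k+3\\ j_3\leq d-(k+3)}}\binom{d-(j_1+j_2+j_3)}{k+3-(j_1+j_2)}\,\alpha_{j_1,j_2,j_3,d-(j_1+j_2+j_3)}\,A^{d-(k+3)-j_3}\,B^{(k+3)-(j_1+j_2)}\,C^{j_2}.$$ These functions are regular at every point of $\ell$ where $\partial f/\partial x_4$ and $\mathfrak{d}_2(f)$ are nonzero; $\mathfrak{b}_j(P)$ denotes the value at $P$. *)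

theory Defs
  imports "HOL-Analysis.Analysis" "HOL-Library.Poly_Mapping"
    "HOL-Computational_Algebra.Polynomial" "HOL-Computational_Algebra.Fraction_Field"
begin

text \<open>
  Quaternary polynomials are finitely supported coefficient functions on the exponents
  \<^typ>\<open>4 \<Rightarrow>\<^sub>0 nat\<close>, with the convolution product of Poly_Mapping. The variables
  are indexed by the elements \<^term>\<open>1::4\<close>, \<^term>\<open>2::4\<close>, \<^term>\<open>3::4\<close>, \<^term>\<open>4::4\<close> of the
  numeral type (which are distinct; as usual \<^prop>\<open>(4::4) = 0\<close>).
\<close>

type_synonym 'a quat_poly = "(4 \<Rightarrow>\<^sub>0 nat) \<Rightarrow>\<^sub>0 'a"

definition Var :: "4 \<Rightarrow> 'a::comm_ring_1 quat_poly" where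
  "Var j = Poly_Mapping.single (Poly_Mapping.single j 1) 1"

definition peval :: "'a::comm_ring_1 quat_poly \<Rightarrow> 'a ^ 4 \<Rightarrow> 'a" where
  "peval f v = (\<Sum>m\<in>Poly_Mapping.keys f.
      Poly_Mapping.lookup f m * (\<Prod>i\<in>UNIV. (v $ i) ^ Poly_Mapping.lookup m i))"

text \<open>The subtraction of exponents truncates only where the coefficient is zero.\<close>

definition pdiff :: "4 \<Rightarrow> 'a::comm_ring_1 quat_poly \<Rightarrow> 'a quat_poly" where
  "pdiff j f = (\<Sum>m\<in>Poly_Mapping.keys f.
      Poly_Mapping.single (m - Poly_Mapping.single j 1)
        (of_nat (Poly_Mapping.lookup m j) * Poly_Mapping.lookup f m))"

definition homogeneous :: "nat \<Rightarrow> 'a::zero quat_poly \<Rightarrow> bool" where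
  "homogeneous d f \<longleftrightarrow>
     (\<forall>m\<in>Poly_Mapping.keys f. (\<Sum>i\<in>UNIV. Poly_Mapping.lookup m i) = d)"

definition principal_ideal :: "'a::comm_ring_1 quat_poly \<Rightarrow> 'a quat_poly set" where
  "principal_ideal f = {h * f | h. True}"


text \<open>
  Points of projective 3-space are the one-dimensional subspaces of \<open>K\<^sup>4\<close>; a polynomial vanishes
  at a point iff it vanishes at all homogeneous coordinate vectors of the point.
\<close>

type_synonym 'a ppoint = "('a ^ 4) set"

definition proj_space :: "'a::field ppoint set" where
  "proj_space = {P. vec.subspace P \<and> vec.dim P = 1}"

definition ppoint_of :: "'a::field ^ 4 \<Rightarrow> 'a ppoint" where
  "ppoint_of v = vec.span {v}"

definition zero_locus :: "'a::field quat_poly set \<Rightarrow> 'a ppoint set" where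
  "zero_locus S = {P \<in> proj_space. \<forall>g\<in>S. \<forall>v\<in>P - {0}. peval g v = 0}"

definition vanishing_ideal :: "'a::field ppoint set \<Rightarrow> 'a quat_poly set" where
  "vanishing_ideal X = {g. \<forall>P\<in>X. \<forall>v\<in>P - {0}. peval g v = 0}"

definition proj_line :: "'a::field ppoint set \<Rightarrow> bool" where
  "proj_line L \<longleftrightarrow>
     (\<exists>W. vec.subspace W \<and> vec.dim W = 2 \<and> L = {P \<in> proj_space. P \<subseteq> W})"

definition algebraic_set :: "'a::field ppoint set \<Rightarrow> bool" where
  "algebraic_set X \<longleftrightarrow> (\<exists>S. (\<forall>g\<in>S. \<exists>e. homogeneous e g) \<and> X = zero_locus S)"

definition surface_of_degree :: "nat \<Rightarrow> 'a::field ppoint set \<Rightarrow> bool" where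
  "surface_of_degree d X \<longleftrightarrow> algebraic_set X \<and>
     (\<exists>F. F \<noteq> 0 \<and> homogeneous d F \<and> vanishing_ideal X = principal_ideal F)"

text \<open>
  Jacobian criterion for a surface in 3-space: at every point the Jacobian matrix of the
  vanishing ideal has rank at least the codimension 1, that is, it is nonzero.
\<close>

definition smooth_surface :: "nat \<Rightarrow> 'a::field ppoint set \<Rightarrow> bool" where
  "smooth_surface d X \<longleftrightarrow> surface_of_degree d X \<and>
     (\<forall>P\<in>X. \<forall>v\<in>P - {0}. \<exists>g\<in>vanishing_ideal X. \<exists>j. peval (pdiff j g) v \<noteq> 0)"

definition ell :: "'a::field ppoint set" where
  "ell = zero_locus {Var 3, Var 4}"


text \<open>
  The field \<open>K(x\<^sub>1, x\<^sub>2)\<close> is the fraction field of \<open>K[x\<^sub>1][x\<^sub>2]\<close>: the inner polynomial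
  variable is \<open>x\<^sub>1\<close>, the outer one is \<open>x\<^sub>2\<close>.
\<close>

definition restrict_ell :: "'a::field quat_poly \<Rightarrow> 'a poly poly" where
  "restrict_ell f =
     (\<Sum>m\<in>{m \<in> Poly_Mapping.keys f. Poly_Mapping.lookup m 3 = 0 \<and> Poly_Mapping.lookup m 4 = 0}.
        monom (monom (Poly_Mapping.lookup f m) (Poly_Mapping.lookup m 1)) (Poly_Mapping.lookup m 2))"

definition on_ell :: "'a::field quat_poly \<Rightarrow> 'a poly poly fract" where
  "on_ell f = Fract (restrict_ell f) 1"

definition const_fract :: "'a::field \<Rightarrow> 'a poly poly fract" where
  "const_fract c = Fract [:[:c:]:] 1"

definition eval2 :: "'a::field poly poly \<Rightarrow> 'a \<Rightarrow> 'a \<Rightarrow> 'a" where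
  "eval2 q a b = poly (poly q [:b:]) a"

text \<open>
  The value at \<open>(a, b)\<close> of a rational function that is regular there; it does not depend on the
  chosen representation, as the lemma below shows.
\<close>

definition fract_value :: "'a::field poly poly fract \<Rightarrow> 'a \<Rightarrow> 'a \<Rightarrow> 'a" where
  "fract_value r a b =
     (THE c. \<exists>p q. r = Fract p q \<and> eval2 q a b \<noteq> 0 \<and> c = eval2 p a b / eval2 q a b)"

lemma fract_value_Fract:
  assumes "eval2 q a b \<noteq> 0"
  shows "fract_value (Fract p q) a b = eval2 p a b / eval2 q a b"
  unfolding fract_value_def
proof (rule the_equality)
  show "\<exists>p' q'. Fract p q = Fract p' q' \<and> eval2 q' a b \<noteq> 0 \<and>
      eval2 p a b / eval2 q a b = eval2 p' a b / eval2 q' a b"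
    using assms by blast
next
  fix c
  assume "\<exists>p' q'. Fract p q = Fract p' q' \<and> eval2 q' a b \<noteq> 0 \<and> c = eval2 p' a b / eval2 q' a b"
  then obtain p' q' where *: "Fract p q = Fract p' q'" "eval2 q' a b \<noteq> 0"
      "c = eval2 p' a b / eval2 q' a b" by blast
  have "q \<noteq> 0" "q' \<noteq> 0" using assms *(2) by (auto simp: eval2_def)
  with *(1) have "p * q' = p' * q" by (simp add: eq_fract)
  then have "eval2 (p * q') a b = eval2 (p' * q) a b" by simp
  then have "eval2 p a b * eval2 q' a b = eval2 p' a b * eval2 q a b" by (simp add: eval2_def)
  then show "c = eval2 p a b / eval2 q a b" unfolding *(3) using assms *(2) by (simp add: divide_simps)
qed

definition frakd :: "4 \<Rightarrow> 'a::field quat_poly \<Rightarrow> 'a quat_poly" where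
  "frakd j f = pdiff j (pdiff 3 f) * pdiff 4 f - pdiff j (pdiff 4 f) * pdiff 3 f"

definition fun_A :: "'a::field quat_poly \<Rightarrow> 'a poly poly fract" where
  "fun_A f = - (on_ell (frakd 1 f) / on_ell (frakd 2 f))"

definition fun_B :: "'a::field quat_poly \<Rightarrow> 'a poly poly fract" where
  "fun_B f = on_ell (pdiff 3 f * frakd 4 f - pdiff 4 f * frakd 3 f) /
             (2 * on_ell (frakd 2 f) * on_ell (pdiff 4 f))"

definition fun_C :: "'a::field quat_poly \<Rightarrow> 'a poly poly fract" where
  "fun_C f = - (on_ell (pdiff 3 f) / on_ell (pdiff 4 f))"

text \<open>Note the order of the indices: \<open>alpha f i j k l\<close> is the coefficient of \<open>x\<^sub>3\<^sup>i x\<^sub>4\<^sup>j x\<^sub>1\<^sup>k x\<^sub>2\<^sup>l\<close>.\<close>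

definition alpha :: "'a::zero quat_poly \<Rightarrow> nat \<Rightarrow> nat \<Rightarrow> nat \<Rightarrow> nat \<Rightarrow> 'a" where
  "alpha f i j k l = Poly_Mapping.lookup f
     (Poly_Mapping.single 3 i + Poly_Mapping.single 4 j +
      Poly_Mapping.single 1 k + Poly_Mapping.single 2 l)"

text \<open>For \<open>k \<le> d - 3\<close> none of the subtractions below truncates.\<close>

definition frakb :: "nat \<Rightarrow> 'a::field quat_poly \<Rightarrow> nat \<Rightarrow> 'a poly poly fract" where
  "frakb d f k =
     (\<Sum>(j1, j2, j3)\<in>{(j1, j2, j3). j1 + j2 \<le> k + 3 \<and> j3 \<le> d - (k + 3)}.
        of_nat ((d - (j1 + j2 + j3)) choose (k + 3 - (j1 + j2))) *
        const_fract (alpha f j1 j2 j3 (d - (j1 + j2 + j3))) *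
        fun_A f ^ (d - (k + 3) - j3) *
        fun_B f ^ (k + 3 - (j1 + j2)) *
        fun_C f ^ j2)"

end

theory Submission
  imports Defs
begin

text \<open>
  A line through \<open>P\<close> other than \<open>ell\<close> is spanned by \<open>p = (1, p2, 0, 0)\<close> and a vector \<open>w\<close> outside the
  plane \<open>x\<^sub>3 = x\<^sub>4 = 0\<close>. If \<open>f (p + t w)\<close> vanishes identically in \<open>t\<close>, its linear Taylor coefficient
  forces \<open>w\<^sub>4 = C w\<^sub>3\<close> and then its quadratic one forces \<open>w\<^sub>2 = A w\<^sub>1 + B w\<^sub>3\<close>, where \<open>A, B, C\<close> are
  taken at \<open>P\<close>. Euler's identity for the partial derivatives of \<open>f\<close> gives \<open>A = p2\<close>, so that
  modulo \<open>p\<close> the direction is a multiple of \<open>q = (0, B, 1, C)\<close>, and the line is unique.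
  Expanding \<open>f (s, A s + B t, t, C t)\<close> by the binomial theorem, the coefficient of
  \<open>s\<^bsup>d-m\<^esup> t\<^bsup>m\<^esup>\<close> is zero for \<open>m < 3\<close> by the choice of \<open>q\<close>, and it is the value at \<open>P\<close> of the
  function \<open>b\<^sub>k\<close> for \<open>m = k + 3\<close>.
\<close>

subsection \<open>Evaluation and formal derivatives\<close>

text \<open>Updating \<open>f\<close> at a fresh exponent amounts to adding a monomial, so
  identities additive in \<open>f\<close> need only be checked on monomials.\<close>

lemma quat_poly_induct [case_names single add]:
  fixes f :: "'a::comm_ring_1 quat_poly"
  assumes single: "\<And>m c. Q (Poly_Mapping.single m c)"
    and add: "\<And>f g. Q f \<Longrightarrow> Q g \<Longrightarrow> Q (f + g)"
  shows "Q f"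
proof (induction f rule: Poly_Mapping.update_induct)
  case const
  show ?case using single[of 0 0] by simp
next
  case (update f m c)
  have "Poly_Mapping.update m c f = f + Poly_Mapping.single m c"
    using update.hyps
    by (intro poly_mapping_eqI) (auto simp: lookup_add lookup_single lookup_update in_keys_iff when_def)
  then show ?case using add[OF update.IH single] by simp
qed

text \<open>A common finite index set lets the sums for \<open>f\<close>, \<open>g\<close> and
  \<open>f + g\<close> be compared term by term.\<close>

lemma peval_superset:
  assumes "finite S" "Poly_Mapping.keys f \<subseteq> S"
  shows "peval f v = (\<Sum>m\<in>S. Poly_Mapping.lookup f m * (\<Prod>i\<in>UNIV. (v $ i) ^ Poly_Mapping.lookup m i))"
  unfolding peval_def by (rule sum.mono_neutral_left) (use assms in \<open>auto simp: in_keys_iff\<close>)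

lemma peval_add: "peval (f + g) v = peval f v + peval g v"
proof -
  let ?S = "Poly_Mapping.keys f \<union> Poly_Mapping.keys g"
  have "Poly_Mapping.keys (f + g) \<subseteq> ?S" by (rule Poly_Mapping.keys_add)
  then show ?thesis
    by (subst (1 2 3) peval_superset[of ?S])
       (auto simp: lookup_add algebra_simps sum.distrib)
qed

lemma peval_single:
  "peval (Poly_Mapping.single m c) v = c * (\<Prod>i\<in>UNIV. (v $ i) ^ Poly_Mapping.lookup m i)"
  by (simp add: peval_def)

lemma peval_zero [simp]: "peval 0 v = 0"
  by (simp add: peval_def)

lemma peval_mult: "peval (f * g) v = peval f v * peval g v"
proof (induction f rule: quat_poly_induct)
  case (single m c)
  show ?case
    by (induction g rule: quat_poly_induct)
       (simp_all add: mult_single peval_single peval_add lookup_add power_add prod.distrib algebra_simps)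
qed (simp_all add: peval_add algebra_simps)

lemma peval_uminus: "peval (- f) v = - peval f v"
  using peval_add[of f "- f" v] by (simp add: add_eq_0_iff)

lemma peval_diff: "peval (f - g) v = peval f v - peval g v"
  using peval_add[of f "- g" v] by (simp add: peval_uminus)

lemma peval_Var: "peval (Var j) v = v $ j"
proof -
  have "(\<Prod>i\<in>UNIV. (v $ i) ^ Poly_Mapping.lookup (Poly_Mapping.single j (1::nat)) i) =
        (\<Prod>i\<in>UNIV. if i = j then v $ i else 1)"
    by (intro prod.cong) (auto simp: lookup_single when_def)
  then show ?thesis by (simp add: Var_def peval_single)
qed

lemma pdiff_superset:
  assumes "finite S" "Poly_Mapping.keys f \<subseteq> S"
  shows "pdiff j f = (\<Sum>m\<in>S. Poly_Mapping.single (m - Poly_Mapping.single j 1)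
        (of_nat (Poly_Mapping.lookup m j) * Poly_Mapping.lookup f m))"
  unfolding pdiff_def by (rule sum.mono_neutral_left) (use assms in \<open>auto simp: in_keys_iff\<close>)

lemma pdiff_add: "pdiff j (f + g) = pdiff j f + pdiff j g"
proof -
  let ?S = "Poly_Mapping.keys f \<union> Poly_Mapping.keys g"
  have "Poly_Mapping.keys (f + g) \<subseteq> ?S" by (rule Poly_Mapping.keys_add)
  then show ?thesis
    by (subst (1 2 3) pdiff_superset[of ?S])
       (auto simp: lookup_add algebra_simps sum.distrib single_add)
qed

lemma pdiff_single:
  "pdiff j (Poly_Mapping.single m c) =
     Poly_Mapping.single (m - Poly_Mapping.single j 1) (of_nat (Poly_Mapping.lookup m j) * c)"
  by (simp add: pdiff_def)

lemma pdiff_commute: "pdiff i (pdiff j f) = pdiff j (pdiff i f)"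
proof (induction f rule: quat_poly_induct)
  case (single m c)
  have "m - Poly_Mapping.single j 1 - Poly_Mapping.single i 1 =
        m - Poly_Mapping.single i 1 - Poly_Mapping.single j (1::nat)"
    by (intro poly_mapping_eqI) (simp add: lookup_minus)
  then show ?case
    by (cases "i = j") (simp_all add: pdiff_single lookup_minus lookup_single mult_ac)
qed (simp add: pdiff_add)

lemma homogeneous_pdiff:
  assumes "homogeneous d f"
  shows "homogeneous (d - 1) (pdiff j f)"
  unfolding homogeneous_def
proof
  fix n assume n: "n \<in> Poly_Mapping.keys (pdiff j f)"
  have "Poly_Mapping.lookup (pdiff j f) n \<noteq> 0" using n by (simp add: in_keys_iff)
  then have "(\<Sum>m\<in>Poly_Mapping.keys f. Poly_Mapping.lookup (Poly_Mapping.single (m - Poly_Mapping.single j 1)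
        (of_nat (Poly_Mapping.lookup m j) * Poly_Mapping.lookup f m)) n) \<noteq> 0"
    unfolding pdiff_def lookup_sum .
  then obtain m where "m \<in> Poly_Mapping.keys f" "Poly_Mapping.lookup (Poly_Mapping.single (m - Poly_Mapping.single j 1)
        (of_nat (Poly_Mapping.lookup m j) * Poly_Mapping.lookup f m)) n \<noteq> 0"
    by (rule sum.not_neutral_contains_not_neutral)
  \<comment> \<open>A surviving term has positive exponent at \<open>j\<close>, so the subtraction
    does not truncate and the degree drops by exactly one.\<close>
  then have m: "m \<in> Poly_Mapping.keys f" "Poly_Mapping.lookup m j \<noteq> 0"
      "n = m - Poly_Mapping.single j 1"
    by (auto simp: lookup_single when_def simp del: One_nat_def intro!: gr0I split: if_splits)
  have "(\<Sum>i\<in>UNIV. Poly_Mapping.lookup m i) = d" using assms m(1) by (simp add: homogeneous_def)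
  moreover have "Poly_Mapping.lookup m i = Poly_Mapping.lookup n i + (if i = j then 1 else 0)" for i
    using m(2,3) by (simp add: lookup_minus lookup_single when_def)
  ultimately show "(\<Sum>i\<in>UNIV. Poly_Mapping.lookup n i) = d - 1"
    by (auto simp: sum.distrib)
qed

lemma euler_identity:
  assumes "homogeneous d f"
  shows "(\<Sum>j\<in>UNIV. v $ j * peval (pdiff j f) v) = of_nat d * peval f v"
proof -
  let ?M = "\<lambda>m. \<Prod>i\<in>UNIV. (v $ i) ^ Poly_Mapping.lookup m i"
  \<comment> \<open>Every monomial is an eigenvector of \<open>x_j d/dx_j\<close>, with its exponent
    at \<open>j\<close> as eigenvalue; summing over \<open>j\<close> gives the total degree.\<close>
  have pw: "v $ j * peval (Poly_Mapping.single (m - Poly_Mapping.single j 1) (of_nat (Poly_Mapping.lookup m j) * c)) v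
      = of_nat (Poly_Mapping.lookup m j) * (c * ?M m)" for j m and c :: 'a
  proof (cases "Poly_Mapping.lookup m j = 0")
    case False
    let ?n = "m - Poly_Mapping.single j 1"
    have "m = Poly_Mapping.single j 1 + ?n"
      using False by (intro poly_mapping_eqI) (auto simp: lookup_add lookup_minus lookup_single when_def)
    then have "c * ?M m = peval (Poly_Mapping.single (Poly_Mapping.single j 1 + ?n) (1 * c)) v"
      by (simp add: peval_single)
    also have "\<dots> = v $ j * (c * ?M ?n)"
      by (simp only: mult_single[symmetric] peval_mult Var_def[symmetric] peval_Var peval_single)
    finally show ?thesis by (simp add: peval_single mult_ac)
  qed (simp add: peval_single)
  have sum_peval: "peval (sum g S) v = (\<Sum>m\<in>S. peval (g m) v)" for g :: "_ \<Rightarrow> 'a quat_poly" and S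
    by (induction S rule: infinite_finite_induct) (simp_all add: peval_add)
  have "(\<Sum>j\<in>UNIV. v $ j * peval (pdiff j f) v) =
        (\<Sum>j\<in>UNIV. \<Sum>m\<in>Poly_Mapping.keys f. of_nat (Poly_Mapping.lookup m j) * (Poly_Mapping.lookup f m * ?M m))"
    by (simp only: pdiff_def sum_peval sum_distrib_left pw)
  also have "\<dots> = (\<Sum>m\<in>Poly_Mapping.keys f. of_nat (\<Sum>j\<in>UNIV. Poly_Mapping.lookup m j) * (Poly_Mapping.lookup f m * ?M m))"
    by (subst sum.swap) (simp add: sum_distrib_right)
  also have "\<dots> = of_nat d * peval f v"
    using assms by (simp add: homogeneous_def peval_def sum_distrib_left)
  finally show ?thesis .
qed

subsection \<open>Restriction to parametrized lines\<close>

text \<open>Substituting univariate polynomials makes the restriction of \<open>f\<close> to a line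
  a polynomial in the parameter, so that its coefficients are available and not only its
  values.\<close>

definition psubst :: "'a::comm_ring_1 quat_poly \<Rightarrow> (4 \<Rightarrow> 'a poly) \<Rightarrow> 'a poly" where
  "psubst f u = (\<Sum>m\<in>Poly_Mapping.keys f.
      smult (Poly_Mapping.lookup f m) (\<Prod>i\<in>UNIV. u i ^ Poly_Mapping.lookup m i))"

lemma psubst_single:
  "psubst (Poly_Mapping.single m c) u = smult c (\<Prod>i\<in>UNIV. u i ^ Poly_Mapping.lookup m i)"
  by (simp add: psubst_def)

lemma psubst_superset:
  assumes "finite S" "Poly_Mapping.keys f \<subseteq> S"
  shows "psubst f u = (\<Sum>m\<in>S. smult (Poly_Mapping.lookup f m) (\<Prod>i\<in>UNIV. u i ^ Poly_Mapping.lookup m i))"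
  unfolding psubst_def by (rule sum.mono_neutral_left) (use assms in \<open>auto simp: in_keys_iff\<close>)

lemma psubst_add: "psubst (f + g) u = psubst f u + psubst g u"
proof -
  let ?S = "Poly_Mapping.keys f \<union> Poly_Mapping.keys g"
  have "Poly_Mapping.keys (f + g) \<subseteq> ?S" by (rule Poly_Mapping.keys_add)
  then show ?thesis
    by (subst (1 2 3) psubst_superset[of ?S])
       (auto simp: lookup_add smult_add_left sum.distrib)
qed

lemma poly_psubst: "poly (psubst f u) t = peval f (\<chi> i. poly (u i) t)"
  by (simp add: psubst_def peval_def poly_sum poly_prod)

text \<open>This is the chain rule; on monomials it reduces to the product and power rules.\<close>

lemma pderiv_psubst:
  fixes f :: "'a::{comm_ring_1, semiring_no_zero_divisors} quat_poly"
  shows "pderiv (psubst f u) = (\<Sum>j\<in>UNIV. psubst (pdiff j f) u * pderiv (u j))"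
proof (induction f rule: quat_poly_induct)
  case (single m c)
  have "(\<Prod>i\<in>UNIV - {j}. u i ^ Poly_Mapping.lookup m i) * pderiv (u j ^ Poly_Mapping.lookup m j)
     = smult (of_nat (Poly_Mapping.lookup m j))
         (\<Prod>i\<in>UNIV. u i ^ Poly_Mapping.lookup (m - Poly_Mapping.single j 1) i) * pderiv (u j)" for j
  proof -
    have "(\<Prod>i\<in>UNIV. u i ^ Poly_Mapping.lookup (m - Poly_Mapping.single j 1) i)
       = u j ^ (Poly_Mapping.lookup m j - 1) * (\<Prod>i\<in>UNIV - {j}. u i ^ Poly_Mapping.lookup m i)"
      by (subst prod.remove[of _ j]) (auto simp: lookup_minus lookup_single intro!: prod.cong)
    then show ?thesis by (simp add: pderiv_power mult_ac)
  qed
  moreover have "smult c (sum g S) = (\<Sum>j\<in>S. smult c (g j))" for g :: "4 \<Rightarrow> 'a poly" and S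
    by (induction S rule: infinite_finite_induct) (simp_all add: smult_add_right)
  ultimately show ?case
    by (simp add: psubst_single pdiff_single pderiv_smult pderiv_prod mult_ac)
qed (simp add: psubst_add pdiff_add pderiv_add algebra_simps sum.distrib)

lemma psubst_line:
  fixes f :: "'a::idom quat_poly"
  defines "G \<equiv> \<lambda>f p w. psubst f (\<lambda>i. [:p $ i, w $ i:])"
  shows poly_psubst_line: "poly (G f p w) t = peval f (p + t *s w)"
    and coeff_1_psubst_line: "coeff (G f p w) 1 = (\<Sum>j\<in>UNIV. peval (pdiff j f) p * w $ j)"
    and coeff_2_psubst_line: "2 * coeff (G f p w) 2 =
           (\<Sum>j\<in>UNIV. \<Sum>k\<in>UNIV. peval (pdiff k (pdiff j f)) p * w $ k * w $ j)"
proof -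
  show val: "poly (G f p w) t = peval f (p + t *s w)" for t and f :: "'a quat_poly"
    by (simp add: G_def poly_psubst plus_vec_def vector_scalar_mult_def)
  have der: "pderiv (G f p w) = (\<Sum>j\<in>UNIV. G (pdiff j f) p w * [:w $ j:])" for f :: "'a quat_poly"
    unfolding G_def by (simp add: pderiv_psubst pderiv_pCons)
  have val0: "poly (G f p w) 0 = peval f p" for f :: "'a quat_poly"
    by (simp add: val)
  show one: "coeff (G f p w) 1 = (\<Sum>j\<in>UNIV. peval (pdiff j f) p * w $ j)" for f :: "'a quat_poly"
  proof -
    have "coeff (G f p w) 1 = poly (pderiv (G f p w)) 0"
      by (simp add: poly_0_coeff_0 coeff_pderiv)
    then show ?thesis by (simp add: der poly_sum val0 mult.commute)
  qed
  have "2 * coeff (G f p w) 2 = coeff (pderiv (G f p w)) 1"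
    by (simp add: coeff_pderiv numeral_2_eq_2)
  also have "\<dots> = (\<Sum>j\<in>UNIV. w $ j * coeff (G (pdiff j f) p w) 1)"
    by (simp add: der coeff_sum)
  finally show "2 * coeff (G f p w) 2 =
           (\<Sum>j\<in>UNIV. \<Sum>k\<in>UNIV. peval (pdiff k (pdiff j f)) p * w $ k * w $ j)"
    by (simp add: one sum_distrib_left mult_ac del: One_nat_def)
qed

text \<open>Moving in the direction of \<open>x_1\<close> or \<open>x_2\<close> stays in the plane,
  so the restriction of \<open>f\<close> has every \<open>t\<close> as a root. In characteristic
  zero it is the zero polynomial, and its linear coefficient is the derivative.\<close>

lemma peval_pdiff_eq_0_on_ell:
  fixes f :: "'a::{idom, ring_char_0} quat_poly"
  assumes "\<And>v. v $ 3 = 0 \<Longrightarrow> v $ 4 = 0 \<Longrightarrow> peval f v = 0"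
    and "v $ 3 = 0" "v $ 4 = 0" "j = 1 \<or> j = 2"
  shows "peval (pdiff j f) v = 0"
proof -
  define G where "G = psubst f (\<lambda>i. [:v $ i, axis j 1 $ i:])"
  have "poly G t = 0" for t
    unfolding G_def poly_psubst_line by (rule assms(1)) (use assms(2-4) in \<open>auto simp: axis_def\<close>)
  then have "G = 0" by (simp add: poly_all_0_iff_0[symmetric])
  then have "0 = (\<Sum>i\<in>UNIV. peval (pdiff i f) v * axis j 1 $ i)"
    unfolding G_def coeff_1_psubst_line[symmetric] by simp
  also have "\<dots> = peval (pdiff j f) v"
    by (simp add: axis_def if_distrib[of "\<lambda>x. _ * x"] cong: if_cong)
  finally show ?thesis by simp
qed

section \<open>Expansion of a homogeneous polynomial along a parametrized line\<close>

lemma vector_4: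
  "(vector [x1, x2, x3, x4] :: 'a::zero ^ 4) $ 1 = x1"
  "(vector [x1, x2, x3, x4] :: 'a ^ 4) $ 2 = x2"
  "(vector [x1, x2, x3, x4] :: 'a ^ 4) $ 3 = x3"
  "(vector [x1, x2, x3, x4] :: 'a ^ 4) $ 4 = x4"
  by (simp_all add: vector_def)

lemma prod_4: "prod g (UNIV :: 4 set) = g 1 * g 2 * g 3 * (g 4 :: 'a::comm_monoid_mult)"
  unfolding UNIV_4 by (simp add: mult_ac)

text \<open>Homogeneity determines the exponent of \<open>x_2\<close> from the other three, so
  triples can index the sum; triples outside the support contribute zero.\<close>

lemma peval_homogeneous_alpha:
  fixes f :: "'a::comm_ring_1 quat_poly"
  assumes "homogeneous d f"
  shows "peval f v = (\<Sum>(j1, j2, j3)\<in>{(j1, j2, j3). j1 + j2 + j3 \<le> d}.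
      alpha f j1 j2 j3 (d - (j1 + j2 + j3)) *
        ((v $ 3) ^ j1 * (v $ 4) ^ j2 * (v $ 1) ^ j3 * (v $ 2) ^ (d - (j1 + j2 + j3))))"
proof -
  define T where "T = {(j1, j2, j3). j1 + j2 + j3 \<le> (d::nat)}"
  define E where "E = (\<lambda>(j1, j2, j3). Poly_Mapping.single 3 j1 + Poly_Mapping.single 4 j2 +
      Poly_Mapping.single 1 j3 + Poly_Mapping.single (2::4) (d - (j1 + j2 + j3)))"
  have E: "Poly_Mapping.lookup (E (j1, j2, j3)) 1 = j3"
          "Poly_Mapping.lookup (E (j1, j2, j3)) 2 = d - (j1 + j2 + j3)"
          "Poly_Mapping.lookup (E (j1, j2, j3)) 3 = j1"
          "Poly_Mapping.lookup (E (j1, j2, j3)) 4 = j2" for j1 j2 j3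
    by (simp_all add: E_def lookup_add lookup_single)
  have "T \<subseteq> {..d} \<times> {..d} \<times> {..d}" by (auto simp: T_def)
  then have fin: "finite T" by (rule finite_subset) auto
  have inj: "inj_on E T"
    by (rule inj_onI) (metis E(1,3,4) prod_cases3)
  have keys: "Poly_Mapping.keys f \<subseteq> E ` T"
  proof
    fix m assume "m \<in> Poly_Mapping.keys f"
    then have deg: "(\<Sum>i\<in>UNIV. Poly_Mapping.lookup m i) = d" using assms by (simp add: homogeneous_def)
    let ?j = "(Poly_Mapping.lookup m 3, Poly_Mapping.lookup m 4, Poly_Mapping.lookup m 1)"
    have "Poly_Mapping.lookup m i = Poly_Mapping.lookup (E ?j) i" for i
      using deg exhaust_4[of i] by (auto simp: E sum_4)
    then have "m = E ?j" by (rule poly_mapping_eqI)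
    moreover have "?j \<in> T" using deg by (auto simp: T_def sum_4)
    ultimately show "m \<in> E ` T" by blast
  qed
  have al: "alpha f j1 j2 j3 (d - (j1 + j2 + j3)) = Poly_Mapping.lookup f (E (j1, j2, j3))" for j1 j2 j3
    by (simp add: alpha_def E_def)
  have "peval f v = (\<Sum>j\<in>T. Poly_Mapping.lookup f (E j) * (\<Prod>i\<in>UNIV. (v $ i) ^ Poly_Mapping.lookup (E j) i))"
    by (subst peval_superset[OF _ keys]) (use fin in \<open>simp_all add: sum.reindex[OF inj]\<close>)
  also have "\<dots> = (\<Sum>(j1, j2, j3)\<in>T. alpha f j1 j2 j3 (d - (j1 + j2 + j3)) *
        ((v $ 3) ^ j1 * (v $ 4) ^ j2 * (v $ 1) ^ j3 * (v $ 2) ^ (d - (j1 + j2 + j3))))"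
    by (intro sum.cong refl) (auto simp: prod_4 E al mult_ac)
  finally show ?thesis by (simp add: T_def)
qed

text \<open>With the functions \<open>A\<close>, \<open>B\<close>, \<open>C\<close> replaced by their values, the index \<open>m = k + 3\<close> gives the value of \<open>b\<^sub>k\<close>.\<close>

definition line_coeff :: "'a::comm_ring_1 quat_poly \<Rightarrow> nat \<Rightarrow> 'a \<Rightarrow> 'a \<Rightarrow> 'a \<Rightarrow> nat \<Rightarrow> 'a" where
  "line_coeff f d a b c m =
     (\<Sum>(j1, j2, j3)\<in>{(j1, j2, j3). j1 + j2 \<le> m \<and> j3 \<le> d - m}.
        of_nat ((d - (j1 + j2 + j3)) choose (m - (j1 + j2))) *
        alpha f j1 j2 j3 (d - (j1 + j2 + j3)) *
        a ^ (d - m - j3) * b ^ (m - (j1 + j2)) * c ^ j2)"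

lemma finite_line_coeff_index: "finite {(j1, j2, j3). j1 + j2 \<le> (m::nat) \<and> j3 \<le> (n::nat)}"
  by (rule finite_subset[of _ "{..m} \<times> {..m} \<times> {..n}"]) auto

lemma peval_line_expansion:
  fixes f :: "'a::comm_ring_1 quat_poly"
  assumes "homogeneous d f"
  shows "peval f (vector [s, a * s + b * t, t, c * t]) =
         (\<Sum>m\<le>d. line_coeff f d a b c m * (s ^ (d - m) * t ^ m))"
proof -
  define T where "T = {(j1, j2, j3). j1 + j2 + j3 \<le> (d::nat)}"
  have "T \<subseteq> {..d} \<times> {..d} \<times> {..d}" by (auto simp: T_def)
  then have fin: "finite T" by (rule finite_subset) auto
  define N where "N = (\<lambda>(j1, j2, j3). {..d - (j1 + j2 + j3 :: nat)})"
  define J where "J m = {(j1, j2, j3). j1 + j2 \<le> m \<and> j3 \<le> d - m}" for m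
  define F where "F = (\<lambda>(j1, j2, j3) i. of_nat ((d - (j1 + j2 + j3)) choose i) *
        alpha f j1 j2 j3 (d - (j1 + j2 + j3)) *
        (a * s) ^ (d - (j1 + j2 + j3) - i) * (b * t) ^ i * (c * t) ^ j2 * t ^ j1 * s ^ j3)"
  have "peval f (vector [s, a * s + b * t, t, c * t]) = (\<Sum>j\<in>T. \<Sum>i\<in>N j. F j i)"
    unfolding peval_homogeneous_alpha[OF assms] T_def[symmetric]
  proof (intro sum.cong refl, clarify)
    fix j1 j2 j3
    let ?n = "d - (j1 + j2 + j3)"
    let ?v = "vector [s, a * s + b * t, t, c * t] :: 'a ^ 4"
    have "(a * s + b * t) ^ ?n = (\<Sum>i\<le>?n. of_nat (?n choose i) * (b * t) ^ i * (a * s) ^ (?n - i))"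
      by (simp add: binomial_ring add.commute[of "a * s"])
    then show "alpha f j1 j2 j3 ?n * (?v $ 3 ^ j1 * ?v $ 4 ^ j2 * ?v $ 1 ^ j3 * ?v $ 2 ^ ?n)
       = (\<Sum>i\<in>N (j1, j2, j3). F (j1, j2, j3) i)"
      by (simp add: vector_4 N_def F_def sum_distrib_left mult_ac)
  qed
  also have "\<dots> = (\<Sum>(j, i)\<in>Sigma T N. F j i)"
    by (rule sum.Sigma) (use fin in \<open>auto simp: N_def\<close>)
  \<comment> \<open>Terms are regrouped by their degree \<open>m = i + j1 + j2\<close> in
    \<open>t\<close>: the factors \<open>b * t\<close>, \<open>t\<close> and \<open>c * t\<close>
    contribute \<open>i\<close>, \<open>j1\<close> and \<open>j2\<close>. The bound on
    \<open>i\<close> turns into \<open>j3 \<le> d - m\<close>.\<close>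
  also have "\<dots> = (\<Sum>(m, j)\<in>Sigma {..d} J. F j (m - (fst j + fst (snd j))))"
    by (rule sum.reindex_bij_witness[of _ "\<lambda>(m, (j1, j2, j3)). ((j1, j2, j3), m - (j1 + j2))"
          "\<lambda>((j1, j2, j3), i). (i + j1 + j2, (j1, j2, j3))"])
       (auto simp: T_def N_def J_def)
  also have "\<dots> = (\<Sum>m\<le>d. \<Sum>j\<in>J m. F j (m - (fst j + fst (snd j))))"
    by (rule sum.Sigma[symmetric]) (auto simp: J_def finite_line_coeff_index)
  also have "\<dots> = (\<Sum>m\<le>d. line_coeff f d a b c m * (s ^ (d - m) * t ^ m))"
  proof (intro sum.cong refl)
    fix m assume "m \<in> {..d}"
    then have m: "m \<le> d" by simp
    have "F (j1, j2, j3) (m - (j1 + j2)) =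
        of_nat ((d - (j1 + j2 + j3)) choose (m - (j1 + j2))) *
        alpha f j1 j2 j3 (d - (j1 + j2 + j3)) *
        a ^ (d - m - j3) * b ^ (m - (j1 + j2)) * c ^ j2 * (s ^ (d - m) * t ^ m)"
      if "j1 + j2 \<le> m" "j3 \<le> d - m" for j1 j2 j3
    proof -
      have e: "d - (j1 + j2 + j3) - (m - (j1 + j2)) = d - m - j3" using that m by linarith
      have s: "s ^ (d - m) = s ^ (d - m - j3) * s ^ j3"
        using that by (metis le_add_diff_inverse2 power_add)
      have t: "t ^ m = t ^ (m - (j1 + j2)) * t ^ j2 * t ^ j1"
        using that by (simp add: power_add[symmetric])
      show ?thesis unfolding F_def prod.case e s t power_mult_distrib by (simp only: mult_ac)
    qed
    then show "(\<Sum>j\<in>J m. F j (m - (fst j + fst (snd j)))) =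
        line_coeff f d a b c m * (s ^ (d - m) * t ^ m)"
      unfolding line_coeff_def sum_distrib_right J_def[symmetric]
      by (intro sum.cong refl) (auto simp: J_def)
  qed
  finally show ?thesis .
qed

subsection \<open>Values of rational functions\<close>

text \<open>The relation passes through the field operations using any representation, so the
  definite description in \<open>fract_value\<close> has to be resolved only once.\<close>

definition has_value :: "'a::field poly poly fract \<Rightarrow> 'a \<Rightarrow> 'a \<Rightarrow> 'a \<Rightarrow> bool" where
  "has_value r x y c \<longleftrightarrow>
     (\<exists>p q. r = Fract p q \<and> eval2 q x y \<noteq> 0 \<and> c = eval2 p x y / eval2 q x y)"

lemma fract_value_eqI: "has_value r x y c \<Longrightarrow> fract_value r x y = c"
  unfolding has_value_def using fract_value_Fract by blast

lemma has_value_Fract_1: "c = eval2 p x y \<Longrightarrow> has_value (Fract p 1) x y c"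
  unfolding has_value_def by (intro exI[of _ p] exI[of _ 1]) (simp add: eval2_def)

lemma has_value_of_nat: "has_value (of_nat n) x y (of_nat n)"
  unfolding of_nat_fract by (rule has_value_Fract_1) (simp add: eval2_def of_nat_poly)

lemma has_value_const_fract: "has_value (const_fract c) x y c"
  unfolding const_fract_def by (rule has_value_Fract_1) (simp add: eval2_def)

lemma has_value_uminus: "has_value r x y c \<Longrightarrow> has_value (- r) x y (- c)"
  unfolding has_value_def by (fastforce simp: eval2_def)

lemma has_value_add:
  assumes "has_value r x y c" "has_value r' x y c'"
  shows "has_value (r + r') x y (c + c')"
proof -
  from assms obtain p q p' q' where
    *: "r = Fract p q" "eval2 q x y \<noteq> 0" "c = eval2 p x y / eval2 q x y"
       "r' = Fract p' q'" "eval2 q' x y \<noteq> 0" "c' = eval2 p' x y / eval2 q' x y"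
    unfolding has_value_def by blast
  from * have "q \<noteq> 0" "q' \<noteq> 0" by (auto simp: eval2_def)
  with *(1,4) have "r + r' = Fract (p * q' + p' * q) (q * q')" by simp
  moreover have "eval2 (q * q') x y \<noteq> 0" using *(2,5) by (simp add: eval2_def)
  moreover have "c + c' = eval2 (p * q' + p' * q) x y / eval2 (q * q') x y"
    unfolding *(3,6) using *(2,5) by (simp add: eval2_def add_frac_eq)
  ultimately show ?thesis unfolding has_value_def by blast
qed

lemma has_value_mult:
  "has_value r x y c \<Longrightarrow> has_value r' x y c' \<Longrightarrow> has_value (r * r') x y (c * c')"
  unfolding has_value_def by (fastforce simp: eval2_def)

lemma has_value_divide:
  "has_value r x y c \<Longrightarrow> has_value r' x y c' \<Longrightarrow> c' \<noteq> 0 \<Longrightarrow> has_value (r / r') x y (c / c')"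
  unfolding has_value_def by (fastforce simp: eval2_def)

lemma has_value_power: "has_value r x y c \<Longrightarrow> has_value (r ^ n) x y (c ^ n)"
  using has_value_of_nat[of 1 x y] by (induction n) (simp_all add: has_value_mult)

lemma has_value_sum:
  "(\<And>i. i \<in> S \<Longrightarrow> has_value (r i) x y (c i)) \<Longrightarrow> has_value (\<Sum>i\<in>S. r i) x y (\<Sum>i\<in>S. c i)"
  using has_value_of_nat[of 0 x y]
  by (induction S rule: infinite_finite_induct) (simp_all add: has_value_add)

text \<open>Monomials involving \<open>x_3\<close> or \<open>x_4\<close> vanish at
  \<open>(x, y, 0, 0)\<close>, and those are exactly the ones that \<open>restrict_ell\<close>
  drops.\<close>

lemma eval2_restrict_ell: "eval2 (restrict_ell f) x y = peval f (vector [x, y, 0, 0])"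
proof -
  have "eval2 (restrict_ell f) x y =
      (\<Sum>m\<in>{m \<in> Poly_Mapping.keys f. Poly_Mapping.lookup m 3 = 0 \<and> Poly_Mapping.lookup m 4 = 0}.
        Poly_Mapping.lookup f m * x ^ Poly_Mapping.lookup m 1 * y ^ Poly_Mapping.lookup m 2)"
    by (simp add: eval2_def restrict_ell_def poly_sum poly_monom mult_ac flip: pCons_one)
  also have "\<dots> = peval f (vector [x, y, 0, 0])"
    unfolding peval_def
    by (rule sum.mono_neutral_cong_left) (auto simp: prod_4 vector_4 power_0_left)
  finally show ?thesis .
qed

lemma has_value_on_ell: "has_value (on_ell f) x y (peval f (vector [x, y, 0, 0]))"
  unfolding on_ell_def by (rule has_value_Fract_1) (simp add: eval2_restrict_ell)

lemma has_value_frakb: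
  assumes "has_value (fun_A f) x y a" "has_value (fun_B f) x y b" "has_value (fun_C f) x y c"
  shows "has_value (frakb d f k) x y (line_coeff f d a b c (k + 3))"
  unfolding frakb_def line_coeff_def case_prod_unfold
  by (intro has_value_sum has_value_mult has_value_of_nat has_value_const_fract has_value_power assms)

subsection \<open>Lines and surfaces\<close>

lemma ppoint_of_in_proj_space:
  assumes "v \<noteq> 0"
  shows "ppoint_of v \<in> proj_space"
proof -
  have "vec.independent {v}" using assms by simp
  then have "vec.dim {v} = 1" by (simp add: vec.dim_eq_card_independent)
  then show ?thesis by (simp add: proj_space_def ppoint_of_def vec.dim_span)
qed

lemma mem_ppoint_of: "v \<in> ppoint_of v"
  by (simp add: ppoint_of_def vec.span_base)

lemma ppoint_of_subset_iff: "vec.subspace W \<Longrightarrow> ppoint_of v \<subseteq> W \<longleftrightarrow> v \<in> W"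
  unfolding ppoint_of_def by (meson empty_subsetI insert_subset subset_trans vec.span_minimal vec.span_superset)

lemma ell_eq: "ell = {P \<in> proj_space. P \<subseteq> {v. v $ 3 = 0 \<and> v $ 4 = 0}}"
  unfolding ell_def zero_locus_def by (auto simp: peval_Var)

text \<open>The polynomials defining \<open>X\<close> lie in its vanishing ideal, hence are
  multiples of \<open>f\<close>, so \<open>f\<close> alone cuts out \<open>X\<close>.\<close>

lemma mem_algebraic_set_iff:
  assumes "algebraic_set X" "vanishing_ideal X = principal_ideal f" "P \<in> proj_space"
  shows "P \<in> X \<longleftrightarrow> (\<forall>v\<in>P - {0}. peval f v = 0)"
proof
  assume "P \<in> X"
  moreover have "f \<in> vanishing_ideal X"
    unfolding assms(2) principal_ideal_def by (auto intro: exI[of _ 1])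
  ultimately show "\<forall>v\<in>P - {0}. peval f v = 0" by (simp add: vanishing_ideal_def)
next
  assume f: "\<forall>v\<in>P - {0}. peval f v = 0"
  obtain S where S: "X = zero_locus S" using assms(1) by (auto simp: algebraic_set_def)
  have "peval g v = 0" if "g \<in> S" "v \<in> P - {0}" for g v
  proof -
    have "g \<in> principal_ideal f"
      unfolding assms(2)[symmetric] using that(1) by (auto simp: S vanishing_ideal_def zero_locus_def)
    then show ?thesis using f that(2) by (auto simp: principal_ideal_def peval_mult)
  qed
  then show "P \<in> X" using assms(3) by (simp add: S zero_locus_def)
qed

text \<open>This turns containment of a projective line into vanishing of \<open>f\<close> on a
  linear plane: each nonzero vector of \<open>W\<close> spans a point inside
  \<open>W\<close>.\<close>

lemma proj_points_subset_iff:
  assumes "algebraic_set X" "vanishing_ideal X = principal_ideal f" "vec.subspace W"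
  shows "{P \<in> proj_space. P \<subseteq> W} \<subseteq> X \<longleftrightarrow> (\<forall>v\<in>W - {0}. peval f v = 0)"
proof
  assume L: "{P \<in> proj_space. P \<subseteq> W} \<subseteq> X"
  show "\<forall>v\<in>W - {0}. peval f v = 0"
  proof
    fix v assume v: "v \<in> W - {0}"
    then have v': "ppoint_of v \<in> proj_space" "ppoint_of v \<subseteq> W"
      by (simp_all add: ppoint_of_in_proj_space ppoint_of_subset_iff assms(3))
    then have "ppoint_of v \<in> X" using L by blast
    then show "peval f v = 0"
      using v v'(1) mem_algebraic_set_iff[OF assms(1,2)] mem_ppoint_of by blast
  qed
next
  assume "\<forall>v\<in>W - {0}. peval f v = 0"
  then show "{P \<in> proj_space. P \<subseteq> W} \<subseteq> X"
    using mem_algebraic_set_iff[OF assms(1,2)] by blast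
qed

lemma subspace_dim_2_eq_span:
  fixes p q :: "'a::field ^ 'n"
  assumes "vec.subspace W" "vec.dim W = 2" "p \<in> W" "q \<in> W" "vec.independent {p, q}" "p \<noteq> q"
  shows "W = vec.span {p, q}"
proof
  show "W \<subseteq> vec.span {p, q}"
    using assms by (intro vec.card_ge_dim_independent) auto
  show "vec.span {p, q} \<subseteq> W"
    using assms by (intro vec.span_minimal) auto
qed

subsection \<open>Lines through the point\<close>

locale surface_at_point =
  fixes f :: "'a::field_char_0 quat_poly" and d :: nat and p2 :: 'a
  assumes degree: "d \<ge> 3"
    and homogeneous: "homogeneous d f"
    and vanishes_on_ell: "\<And>v. v $ 3 = 0 \<Longrightarrow> v $ 4 = 0 \<Longrightarrow> peval f v = 0"
    and pdiff_4_nonzero: "peval (pdiff 4 f) (vector [1, p2, 0, 0]) \<noteq> 0"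
    and frakd_2_nonzero: "peval (frakd 2 f) (vector [1, p2, 0, 0]) \<noteq> 0"
begin

definition p :: "'a ^ 4" where "p = vector [1, p2, 0, 0]"

definition D :: "4 \<Rightarrow> 'a" where "D i = peval (pdiff i f) p"

definition H :: "4 \<Rightarrow> 4 \<Rightarrow> 'a" where "H i j = peval (pdiff i (pdiff j f)) p"

definition dd :: "4 \<Rightarrow> 'a" where "dd j = peval (frakd j f) p"

definition a :: 'a where "a = - (dd 1 / dd 2)"

definition b :: 'a where "b = (D 3 * dd 4 - D 4 * dd 3) / (2 * dd 2 * D 4)"

definition c :: 'a where "c = - (D 3 / D 4)"

definition q :: "'a ^ 4" where "q = vector [0, b, 1, c]"

lemma p_nth [simp]: "p $ 1 = 1" "p $ 2 = p2" "p $ 3 = 0" "p $ 4 = 0"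
  by (simp_all add: p_def vector_4)

lemma q_nth [simp]: "q $ 1 = 0" "q $ 2 = b" "q $ 3 = 1" "q $ 4 = c"
  by (simp_all add: q_def vector_4)

lemma nonzero: "D 4 \<noteq> 0" "dd 2 \<noteq> 0"
  using pdiff_4_nonzero frakd_2_nonzero by (simp_all add: D_def dd_def p_def)

lemma dd_eq: "dd j = H j 3 * D 4 - H j 4 * D 3"
  by (simp add: dd_def frakd_def D_def H_def peval_diff peval_mult)

lemma H_commute: "H i j = H j i"
  unfolding H_def by (simp only: pdiff_commute)

lemma D_ell: "D 1 = 0" "D 2 = 0"
  unfolding D_def by (rule peval_pdiff_eq_0_on_ell; simp add: vanishes_on_ell)+

text \<open>The first derivatives along \<open>ell\<close> vanish on the whole plane, so they can be
  differentiated along \<open>ell\<close> once more.\<close>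

lemma H_ell: "i = 1 \<or> i = 2 \<Longrightarrow> j = 1 \<or> j = 2 \<Longrightarrow> H i j = 0"
  unfolding H_def
  by (intro peval_pdiff_eq_0_on_ell[of "pdiff j f"] peval_pdiff_eq_0_on_ell[of f] vanishes_on_ell) auto

text \<open>Euler's identity is applied at \<open>p\<close> to the third and fourth partial
  derivatives. Weighting the results by \<open>D 4\<close> and \<open>- D 3\<close> cancels the
  right-hand sides.\<close>

lemma a_eq: "a = p2"
proof -
  have "H 1 j + p2 * H 2 j = of_nat (d - 1) * D j" for j
    using euler_identity[OF homogeneous_pdiff[OF homogeneous, of j], of p]
    by (simp add: sum_4 H_def D_def)
  from this[of 3] this[of 4] have "dd 1 + p2 * dd 2 = 0"
    unfolding dd_eq by algebra
  then have "- dd 1 = p2 * dd 2" by algebra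
  then show ?thesis using nonzero by (simp add: a_def field_simps)
qed

section \<open>Taylor coefficients of \<open>f\<close> at \<open>p\<close>\<close>

definition G :: "'a ^ 4 \<Rightarrow> 'a poly" where "G w = psubst f (\<lambda>i. [:p $ i, w $ i:])"

lemma poly_G: "poly (G w) t = peval f (p + t *s w)"
  by (simp add: G_def poly_psubst_line)

lemma coeff_G_0: "coeff (G w) 0 = 0"
  using poly_G[of w 0] by (simp add: poly_0_coeff_0 vanishes_on_ell)

text \<open>As \<open>D 1\<close> and \<open>D 2\<close> vanish, only the third and fourth
  coordinates enter; \<open>c\<close> is the slope of the tangent plane in them.\<close>

lemma coeff_G_1: "coeff (G w) 1 = D 4 * (w $ 4 - c * w $ 3)"
  using coeff_1_psubst_line[of f p w] nonzero
  by (simp add: G_def sum_4 D_def[symmetric] D_ell c_def field_simps)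

text \<open>The Hessian block in \<open>x_1, x_2\<close> is zero, so on the tangent plane the
  quadratic form is divisible by \<open>w $ 3\<close>. The remaining linear factor is what
  \<open>a\<close> and \<open>b\<close> encode.\<close>

lemma coeff_G_2:
  assumes "w $ 4 = c * w $ 3"
  shows "D 4 * coeff (G w) 2 = w $ 3 * dd 2 * (w $ 2 - a * w $ 1 - b * w $ 3)"
proof -
  have "2 * coeff (G w) 2 = 2 * w $ 1 * (H 1 3 * w $ 3 + H 1 4 * w $ 4) +
      2 * w $ 2 * (H 2 3 * w $ 3 + H 2 4 * w $ 4) +
      H 3 3 * (w $ 3)^2 + 2 * H 3 4 * w $ 3 * w $ 4 + H 4 4 * (w $ 4)^2"
    using coeff_2_psubst_line[of f p w]
    by (simp add: G_def[symmetric] sum_4 H_def[symmetric] H_ell H_commute[of 3 1] H_commute[of 4 1]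
        H_commute[of 3 2] H_commute[of 4 2] H_commute[of 4 3] power2_eq_square algebra_simps)
  \<comment> \<open>The square of \<open>D 4\<close> clears the denominator of \<open>c ^ 2\<close>.
    The pure \<open>w $ 3\<close> part then becomes \<open>D 4 * dd 3 - D 3 * dd 4\<close>, which is
    the numerator of \<open>b\<close> up to sign.\<close>
  then have "2 * (D 4 * D 4 * coeff (G w) 2) = D 4 * D 4 * (2 * w $ 1 * (H 1 3 * w $ 3 + H 1 4 * w $ 4) +
      2 * w $ 2 * (H 2 3 * w $ 3 + H 2 4 * w $ 4) +
      H 3 3 * (w $ 3)^2 + 2 * H 3 4 * w $ 3 * w $ 4 + H 4 4 * (w $ 4)^2)"
    by algebra
  moreover have "D 4 * c = - D 3" using nonzero by (simp add: c_def)
  moreover have "dd 2 * a = - dd 1" using nonzero by (simp add: a_def)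
  moreover have "2 * dd 2 * D 4 * b = D 3 * dd 4 - D 4 * dd 3" using nonzero by (simp add: b_def)
  ultimately have "2 * (D 4 * D 4 * coeff (G w) 2) =
      2 * (D 4 * (w $ 3 * dd 2 * (w $ 2 - a * w $ 1 - b * w $ 3)))"
    using assms dd_eq[of 1] dd_eq[of 2] dd_eq[of 3] dd_eq[of 4] H_commute[of 4 3] by algebra
  then show ?thesis using nonzero by simp
qed

lemma direction_of_line:
  assumes zero: "\<And>t. peval f (p + t *s w) = 0" and w: "\<not> (w $ 3 = 0 \<and> w $ 4 = 0)"
  shows "w $ 3 \<noteq> 0" "w = w $ 1 *s p + w $ 3 *s q"
proof -
  have "G w = 0" using zero by (simp add: poly_all_0_iff_0[symmetric] poly_G)
  then have w4: "w $ 4 = c * w $ 3" using coeff_G_1[of w] nonzero by simp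
  then show w3: "w $ 3 \<noteq> 0" using w by auto
  have w2: "w $ 2 = a * w $ 1 + b * w $ 3"
    using coeff_G_2[OF w4] \<open>G w = 0\<close> nonzero w3 by (simp add: diff_diff_eq)
  \<comment> \<open>Since \<open>a = p2\<close>, the part \<open>a * w $ 1\<close> of the second
    coordinate is absorbed by the multiple of \<open>p\<close>.\<close>
  have "w $ i = (w $ 1 *s p + w $ 3 *s q) $ i" for i
    using exhaust_4[of i] w4 w2 by (auto simp: a_eq mult.commute)
  then show "w = w $ 1 *s p + w $ 3 *s q" unfolding vec_eq_iff by blast
qed

lemma peval_span_p_q:
  "peval f (s *s p + t *s q) = (\<Sum>m\<le>d. line_coeff f d a b c m * (s ^ (d - m) * t ^ m))"
proof -
  have "(s *s p + t *s q) $ i = (vector [s, a * s + b * t, t, c * t] :: 'a ^ 4) $ i" for i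
    using exhaust_4[of i] by (auto simp: a_eq vector_4 mult.commute)
  then have "s *s p + t *s q = vector [s, a * s + b * t, t, c * t]" by (simp add: vec_eq_iff)
  then show ?thesis by (simp add: peval_line_expansion[OF homogeneous])
qed

text \<open>Setting \<open>s = 1\<close> gives two polynomials in \<open>t\<close> with equal values
  everywhere; over an infinite field their coefficients agree.\<close>

lemma line_coeff_eq_coeff_G:
  assumes "m \<le> d"
  shows "line_coeff f d a b c m = coeff (G q) m"
proof -
  have "G q = (\<Sum>m\<le>d. monom (line_coeff f d a b c m) m)"
    using peval_span_p_q[of 1]
    by (intro poly_eq_poly_eq_iff[THEN iffD1] ext) (simp add: poly_G poly_sum poly_monom)
  then show ?thesis using assms by (simp add: coeff_sum)
qed

text \<open>The vector \<open>q\<close> solves the linear and quadratic conditions by construction,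
  and the constant term is \<open>f\<close> at \<open>p\<close>.\<close>

lemma line_coeff_low:
  assumes "m < 3"
  shows "line_coeff f d a b c m = 0"
proof -
  have "coeff (G q) 1 = 0" "coeff (G q) 2 = 0"
    using coeff_G_1[of q] coeff_G_2[of q] nonzero by simp_all
  moreover have "m = 0 \<or> m = 1 \<or> m = 2" using assms by auto
  ultimately show ?thesis
    using degree coeff_G_0[of q] line_coeff_eq_coeff_G[of m] by auto
qed

text \<open>The indices \<open>k + 3\<close> run through the coefficients from 3 to
  \<open>d\<close>, and the lower ones are already zero.\<close>

lemma vanishes_on_span_iff:
  "(\<forall>s t. peval f (s *s p + t *s q) = 0) \<longleftrightarrow> (\<forall>k\<in>{0..d - 3}. line_coeff f d a b c (k + 3) = 0)"
proof
  assume "\<forall>s t. peval f (s *s p + t *s q) = 0"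
  from this[THEN spec, of 1] have "G q = 0" by (simp add: poly_all_0_iff_0[symmetric] poly_G)
  then show "\<forall>k\<in>{0..d - 3}. line_coeff f d a b c (k + 3) = 0"
    using degree by (simp add: line_coeff_eq_coeff_G)
next
  assume high: "\<forall>k\<in>{0..d - 3}. line_coeff f d a b c (k + 3) = 0"
  have "line_coeff f d a b c m = 0" if "m \<le> d" for m
  proof (cases "m < 3")
    case False
    then show ?thesis using high[rule_format, of "m - 3"] that by simp
  qed (rule line_coeff_low)
  then show "\<forall>s t. peval f (s *s p + t *s q) = 0" by (simp add: peval_span_p_q)
qed

lemma fract_value_frakb: "fract_value (frakb d f k) 1 p2 = line_coeff f d a b c (k + 3)"
proof (intro fract_value_eqI has_value_frakb)
  have val: "has_value (on_ell g) 1 p2 (peval g p)" for g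
    unfolding p_def by (rule has_value_on_ell)
  show "has_value (fun_A f) 1 p2 a"
    unfolding fun_A_def a_def using nonzero
    by (intro has_value_uminus has_value_divide) (auto simp: dd_def val)
  show "has_value (fun_C f) 1 p2 c"
    unfolding fun_C_def c_def using nonzero
    by (intro has_value_uminus has_value_divide) (auto simp: D_def val)
  have "has_value 2 1 p2 2" using has_value_of_nat[of 2] by simp
  moreover have "D 3 * dd 4 - D 4 * dd 3 = peval (pdiff 3 f * frakd 4 f - pdiff 4 f * frakd 3 f) p"
    by (simp add: D_def dd_def peval_diff peval_mult)
  ultimately show "has_value (fun_B f) 1 p2 b"
    unfolding fun_B_def b_def using nonzero
    by (intro has_value_divide has_value_mult) (auto simp: D_def dd_def val)
qed

section \<open>The plane spanned by \<open>p\<close> and \<open>q\<close>\<close>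

lemma independent_p_q: "vec.independent {p, q}" "p \<noteq> q"
proof -
  show "p \<noteq> q" by (metis p_nth(3) q_nth(3) zero_neq_one)
  have "p \<noteq> 0" by (metis p_nth(1) zero_index zero_neq_one)
  moreover have "q \<notin> vec.span {p}"
  proof
    assume "q \<in> vec.span {p}"
    then obtain k where "q = k *s p" by (auto simp: vec.span_singleton)
    then have "q $ 3 = 0" by simp
    then show False by simp
  qed
  ultimately have "vec.independent {q, p}" by (simp add: vec.independent_insert)
  then show "vec.independent {p, q}" by (simp add: insert_commute)
qed

lemma mem_span_p_q: "v \<in> vec.span {p, q} \<longleftrightarrow> (\<exists>s t. v = s *s p + t *s q)"
proof -
  have "v - s *s p = t *s q \<longleftrightarrow> v = s *s p + t *s q" for s t
    by (simp add: diff_eq_eq add.commute)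
  then show ?thesis by (auto simp: vec.span_insert vec.span_singleton)
qed

lemma plane_eq_span_p_q:
  assumes W: "vec.subspace W" "vec.dim W = 2" "p \<in> W"
    and not_ell: "W \<noteq> {v. v $ 3 = 0 \<and> v $ 4 = 0}"
    and zero: "\<forall>v\<in>W - {0}. peval f v = 0"
  shows "W = vec.span {p, q}"
proof -
  let ?W0 = "{v :: 'a ^ 4. v $ 3 = 0 \<and> v $ 4 = 0}"
  \<comment> \<open>As a coordinate subspace, the plane has its dimension given by
    \<open>dim_substandard_cart\<close>.\<close>
  have W0: "?W0 = {v. \<forall>i. i \<notin> {1, 2} \<longrightarrow> v $ i = 0}"
    by (auto simp: forall_4)
  have "\<not> W \<subseteq> ?W0"
  proof
    assume "W \<subseteq> ?W0"
    moreover have "vec.dim ?W0 = 2" unfolding W0 dim_substandard_cart by simp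
    moreover have "vec.subspace ?W0" by (simp add: vec.subspace_def)
    ultimately have "W = ?W0" using W by (intro vec.subspace_dim_equal) auto
    with not_ell show False by contradiction
  qed
  then obtain w where w: "w \<in> W" "\<not> (w $ 3 = 0 \<and> w $ 4 = 0)" by auto
  \<comment> \<open>The hypothesis covers only nonzero vectors; at the zero vector, vanishing on
    \<open>ell\<close> takes over.\<close>
  have "peval f (p + t *s w) = 0" for t
  proof (cases "p + t *s w = 0")
    case False
    then show ?thesis using zero W w by (simp add: vec.subspace_add vec.subspace_scale)
  qed (simp add: vanishes_on_ell)
  note dir = direction_of_line[OF this w(2)]
  have "w - w $ 1 *s p = w $ 3 *s q" using dir(2) by (metis add_diff_cancel_left')
  then have "q = inverse (w $ 3) *s (w - w $ 1 *s p)" using dir(1) by simp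
  then have "q \<in> W" using W w(1) by (metis vec.subspace_diff vec.subspace_scale)
  then show ?thesis using W independent_p_q by (intro subspace_dim_2_eq_span)
qed

end

theorem proposition3p7:
  fixes X :: "'a::{alg_closed_field, field_char_0} ppoint set"
    and f :: "'a quat_poly" and d :: nat and p2 :: 'a and P :: "'a ppoint"
  assumes "d \<ge> 3"
    and "smooth_surface d X"
    and "ell \<subseteq> X"
    and "homogeneous d f"
    and "vanishing_ideal X = principal_ideal f"
    and "P = ppoint_of (vector [1, p2, 0, 0])"
    and "peval (pdiff 4 f) (vector [1, p2, 0, 0]) \<noteq> 0"
    and "peval (frakd 2 f) (vector [1, p2, 0, 0]) \<noteq> 0"
  shows "(\<forall>L1 L2. proj_line L1 \<and> L1 \<noteq> ell \<and> P \<in> L1 \<and> L1 \<subseteq> X \<and>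
                  proj_line L2 \<and> L2 \<noteq> ell \<and> P \<in> L2 \<and> L2 \<subseteq> X \<longrightarrow> L1 = L2) \<and>
         ((\<exists>L. proj_line L \<and> L \<noteq> ell \<and> P \<in> L \<and> L \<subseteq> X) \<longleftrightarrow>
          (\<forall>j\<in>{0..d - 3}. fract_value (frakb d f j) 1 p2 = 0))"
proof -
  have alg: "algebraic_set X"
    using assms(2) by (simp add: smooth_surface_def surface_of_degree_def)
  note subset_X = proj_points_subset_iff[OF alg assms(5)]
  have "vec.subspace {v :: 'a ^ 4. v $ 3 = 0 \<and> v $ 4 = 0}" by (simp add: vec.subspace_def)
  then have "\<forall>v\<in>{v. v $ 3 = 0 \<and> v $ 4 = 0} - {0}. peval f v = 0"
    using assms(3) subset_X unfolding ell_eq by blast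
  \<comment> \<open>The zero vector represents no point, so its value comes from Euler's identity
    with \<open>d\<close> nonzero.\<close>
  moreover have "peval f 0 = 0"
    using euler_identity[OF assms(4), of 0] assms(1) by simp
  ultimately have "peval f v = 0" if "v $ 3 = 0" "v $ 4 = 0" for v
    using that by (cases "v = 0") auto
  then interpret surface_at_point f d p2
    using assms by unfold_locales auto
  define M where "M = {Q \<in> proj_space. Q \<subseteq> vec.span {p, q}}"
  have P: "P = ppoint_of p" by (simp add: assms(6) p_def)
  \<comment> \<open>One fact serves twice: \<open>L = M\<close> gives uniqueness, and the vanishing
    of \<open>f\<close> on the span gives the implication from (a) to (b).\<close>
  have unique: "L = M \<and> (\<forall>s t. peval f (s *s p + t *s q) = 0)"
    if L: "proj_line L" "L \<noteq> ell" "P \<in> L" "L \<subseteq> X" for L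
  proof -
    obtain W where W: "vec.subspace W" "vec.dim W = 2" "L = {Q \<in> proj_space. Q \<subseteq> W}"
      using L(1) by (auto simp: proj_line_def)
    have zero: "\<forall>v\<in>W - {0}. peval f v = 0" using L(4) W subset_X by blast
    have "p \<in> W" using L(3) W by (simp add: P ppoint_of_subset_iff)
    then have eq: "W = vec.span {p, q}"
      using W L(2) zero by (intro plane_eq_span_p_q) (auto simp: ell_eq)
    have "peval f (s *s p + t *s q) = 0" for s t
      using zero \<open>peval f 0 = 0\<close> mem_span_p_q unfolding eq
      by (cases "s *s p + t *s q = 0") (simp, blast)
    then show ?thesis using W(3) eq by (simp add: M_def)
  qed
  have exists: "proj_line M \<and> M \<noteq> ell \<and> P \<in> M \<and> M \<subseteq> X"
    if zero: "\<forall>s t. peval f (s *s p + t *s q) = 0"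
  proof (intro conjI)
    have "vec.dim (vec.span {p, q}) = 2"
      using independent_p_q by (simp add: vec.dim_span vec.dim_eq_card_independent)
    then show "proj_line M" unfolding proj_line_def M_def by blast
    have "p \<noteq> 0" by (metis p_nth(1) zero_index zero_neq_one)
    then show "P \<in> M"
      by (simp add: M_def P ppoint_of_in_proj_space ppoint_of_subset_iff vec.span_base)
    have "q \<noteq> 0" by (metis q_nth(3) zero_index zero_neq_one)
    then have "ppoint_of q \<in> M"
      by (simp add: M_def ppoint_of_in_proj_space ppoint_of_subset_iff vec.span_base)
    \<comment> \<open>The third coordinate of \<open>q\<close> is 1, so its point separates
      \<open>M\<close> from \<open>ell\<close>.\<close>
    moreover have "ppoint_of q \<notin> ell"
      unfolding ell_eq using mem_ppoint_of[of q] by (auto simp: subset_iff intro!: bexI[of _ q] exI[of _ q])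
    ultimately show "M \<noteq> ell" by blast
    show "M \<subseteq> X"
      unfolding M_def using zero by (subst subset_X) (auto simp: mem_span_p_q)
  qed
  show ?thesis
    unfolding fract_value_frakb vanishes_on_span_iff[symmetric]
  proof (intro conjI allI impI)
    show "L1 = L2" if "proj_line L1 \<and> L1 \<noteq> ell \<and> P \<in> L1 \<and> L1 \<subseteq> X \<and>
        proj_line L2 \<and> L2 \<noteq> ell \<and> P \<in> L2 \<and> L2 \<subseteq> X" for L1 L2
      using that unique[of L1] unique[of L2] by simp
    show "(\<exists>L. proj_line L \<and> L \<noteq> ell \<and> P \<in> L \<and> L \<subseteq> X) \<longleftrightarrow>
        (\<forall>s t. peval f (s *s p + t *s q) = 0)"
    proof
      assume "\<exists>L. proj_line L \<and> L \<noteq> ell \<and> P \<in> L \<and> L \<subseteq> X"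
      then obtain L where "proj_line L" "L \<noteq> ell" "P \<in> L" "L \<subseteq> X" by (elim exE conjE)
      then show "\<forall>s t. peval f (s *s p + t *s q) = 0" by (rule unique[THEN conjunct2])
    qed (intro exI[of _ M], rule exists)
  qed
qed

end
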